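(* Let $I$ be a countably infinite set and let $(T_n)_{n\in\mathbb{N}}$ be a sequence of weighted pseudo-shifts on $c_0(I)$ given by $T_n[(x_i)_{i\in I}]=(b_i^n x_{\phi_n(i)})_{i\in I}$, where the $b_i^n$ ($n\in\mathbb{N}$, $i\in I$) are positive real numbers and each $\phi_n:I\to I$ is injective. Assume that: (i) $(\phi_n)_n$ is a run-away sequence, i.e. for any finite subsets $I_0,J_0\subseteq I$ there exists $n_0\in\mathbb{N}$ such that $\phi_n(J_0)\cap I_0=\emptyset$ for every $n\ge n_0$; (ii) there exists $\rho>1$ such that $\frac{1}{\rho^{|n-m|}}\le \frac{b_s^n}{b_t^m}$ for all $n,m\in\mathbb{N}$ and $s,t\in I$ such that $\phi_n(s)=\phi_m(t)$; (iii) there exists $g:I\to\mathbb{R}$ such that $|n-m|\le |g(s)-g(t)|$ for all $n,m\in\mathbb{N}$ and $s,t\in I$ such that $\phi_n(s)=\phi_m(t)$; (iv) $(W_p)_{p\in\mathbb{N}}$ is an increasing sequence of finite subsets of $I$ such that $I=\bigcup_{p=1}^\infty W_p$. Then $(T_n)_{n\in\mathbb{N}}$ is frequently universal on $c_0(I)$ if and only if there exist a sequence $(M(p))_{p\in\mathbb{N}}$ of positive real numbers tending to $\infty$ and a sequence $(E_p)_{p\in\mathbb{N}}$ of subsets of $\mathbb{N}$ such that: (a) for any $p\ge 1$, $\underline{\mathrm{dens}}(E_p)>0$; (b) for any distinct $p,q\ge 1$, any $n\in E_p$ and any $m\in E_q$, $\phi_n(W_p)\cap\phi_m(W_q)=\emptyset$;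 (c) for every $p\ge 1$ and every $s\in W_p$, $\lim_{n\to\infty,\,n\in E_p} b_s^n=\infty$; (d) for any $p,q\ge1$, $n\in E_p$, $m\in E_q$ with $n\ne m$, $t\in W_q$ and $s\in I$ such that $\phi_n(s)=\phi_m(t)$, $$\frac{b_s^n}{b_t^m}\le\frac{1}{M(p)M(q)}.$$ Moreover, the same equivalence holds with "there exist a sequence $(M(p))_{p\in\mathbb{N}}$ and a sequence $(E_p)_{p\in\mathbb{N}}$" replaced by "for any sequence $(M(p))_{p\in\mathbb{N}}$ (of positive real numbers tending to $\infty$) there exists a sequence $(E_p)_{p\in\mathbb{N}}$".
   Context: $\mathbb{N}=\{1,2,\dots\}$. For a countable set $I$, $c_0(I)$ is the Banach space of all real families $(x_i)_{i\in I}$ such that for every $\varepsilon>0$ there is a finite $J\subseteq I$ with $|x_i|<\varepsilon$ for all $i\in I\setminus J$, with norm $\|(x_i)_{i\in I}\|=\sup_{i\in I}|x_i|$. A weighted pseudo-shift on $c_0(I)$ is a continuous linear operator $T:c_0(I)\to c_0(I)$ of the form $T[(x_i)_{i\in I}]=(b_i x_{\phi(i)})_{i\in I}$, where $(b_i)_{i\in I}$ are non-zero scalars and $\phi:I\to I$ is injective. The lower density of $A\subseteq\mathbb{N}$ is $\underline{\mathrm{dens}}(A)=\liminf_{N\to\infty}\#\{n\le N: n\in A\}/N$. A sequence $(T_n)_{n\in\mathbb{N}}$ of continuous maps from a topological space $X$ to a topological space $Y$ is frequently universal if there exists $x\in X$ such that $\underline{\mathrm{dens}}(\{n\in\mathbb{N}: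 T_nx\in U\})>0$ for every non-empty open set $U\subseteq Y$. *)

theory Defs
  imports "HOL-Analysis.Analysis"
begin

section \<open>The Banach space of null families\<close>

typedef 'i c0 =
  "{x :: 'i \<Rightarrow> real. \<forall>\<epsilon>>0. \<exists>J. finite J \<and> (\<forall>i\<in>- J. \<bar>x i\<bar> < \<epsilon>)}"
  morphisms c0_nth Abs_c0
  by (rule exI[of _ "\<lambda>_. 0"]) (auto intro!: exI[of _ "{}"])

setup_lifting type_definition_c0

lemma c0_eqI: "(\<And>i. c0_nth x i = c0_nth y i) \<Longrightarrow> x = y"
  by transfer auto

lemma c0_small:
  assumes "0 < \<epsilon>"
  obtains J where "finite J" "\<And>i. i \<notin> J \<Longrightarrow> \<bar>c0_nth x i\<bar> < \<epsilon>"
  using assms c0_nth[of x] by (auto 0 3)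

lemma c0_bdd_above: "bdd_above (range (\<lambda>i. \<bar>c0_nth x i\<bar>))"
proof -
  obtain J where J: "finite J" "\<And>i. i \<notin> J \<Longrightarrow> \<bar>c0_nth x i\<bar> < 1"
    by (rule c0_small[of 1]) auto
  have "bdd_above ((\<lambda>i. \<bar>c0_nth x i\<bar>) ` J)"
    using J(1) by simp
  then obtain B where B: "\<And>i. i \<in> J \<Longrightarrow> \<bar>c0_nth x i\<bar> \<le> B"
    by (auto simp: bdd_above_def)
  show ?thesis
  proof (rule bdd_aboveI2)
    fix i
    show "\<bar>c0_nth x i\<bar> \<le> max 1 B"
      using B[of i] J(2)[of i] by (cases "i \<in> J") (auto simp: le_max_iff_disj less_imp_le)
  qed
qed

instantiation c0 :: (type) real_vector
begin

lift_definition zero_c0 :: "'a c0" is "\<lambda>_. 0"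
  by (auto intro!: exI[of _ "{}"])

lift_definition uminus_c0 :: "'a c0 \<Rightarrow> 'a c0" is "\<lambda>x i. - x i"
  by simp

lift_definition plus_c0 :: "'a c0 \<Rightarrow> 'a c0 \<Rightarrow> 'a c0" is "\<lambda>x y i. x i + y i"
proof -
  fix x y :: "'a \<Rightarrow> real" and \<epsilon> :: real
  assume x: "\<And>\<epsilon>. 0 < \<epsilon> \<Longrightarrow> \<exists>J. finite J \<and> (\<forall>i\<in>- J. \<bar>x i\<bar> < \<epsilon>)"
    and y: "\<And>\<epsilon>. 0 < \<epsilon> \<Longrightarrow> \<exists>J. finite J \<and> (\<forall>i\<in>- J. \<bar>y i\<bar> < \<epsilon>)" and e: "0 < \<epsilon>"
  obtain J where J: "finite J" "\<forall>i\<in>- J. \<bar>x i\<bar> < \<epsilon> / 2"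
    using x e half_gt_zero by blast
  obtain K where K: "finite K" "\<forall>i\<in>- K. \<bar>y i\<bar> < \<epsilon> / 2"
    using y e half_gt_zero by blast
  have "\<bar>x i + y i\<bar> < \<epsilon>" if "i \<in> - (J \<union> K)" for i
  proof -
    have "\<bar>x i\<bar> < \<epsilon> / 2" "\<bar>y i\<bar> < \<epsilon> / 2"
      using that J(2) K(2) by auto
    then show ?thesis by linarith
  qed
  then show "\<exists>J. finite J \<and> (\<forall>i\<in>- J. \<bar>x i + y i\<bar> < \<epsilon>)"
    using J(1) K(1) by (intro exI[of _ "J \<union> K"]) auto
qed

definition minus_c0 :: "'a c0 \<Rightarrow> 'a c0 \<Rightarrow> 'a c0" where
  "minus_c0 x y = x + - y"

lift_definition scaleR_c0 :: "real \<Rightarrow> 'a c0 \<Rightarrow> 'a c0" is "\<lambda>r x i. r * x i"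
proof -
  fix r :: real and x :: "'a \<Rightarrow> real" and \<epsilon> :: real
  assume x: "\<And>\<epsilon>. 0 < \<epsilon> \<Longrightarrow> \<exists>J. finite J \<and> (\<forall>i\<in>- J. \<bar>x i\<bar> < \<epsilon>)" and e: "0 < \<epsilon>"
  have "0 < \<epsilon> / (\<bar>r\<bar> + 1)"
    using e by (simp add: add_nonneg_pos)
  then obtain J where J: "finite J" "\<forall>i\<in>- J. \<bar>x i\<bar> < \<epsilon> / (\<bar>r\<bar> + 1)"
    using x by blast
  have "\<bar>r * x i\<bar> < \<epsilon>" if "i \<in> - J" for i
  proof -
    have "\<bar>x i\<bar> * (\<bar>r\<bar> + 1) < \<epsilon>"
      using J(2) that by (simp add: pos_less_divide_eq add_nonneg_pos)
    then show ?thesis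
      using abs_ge_zero[of "x i"] by (simp add: abs_mult algebra_simps)
  qed
  then show "\<exists>J. finite J \<and> (\<forall>i\<in>- J. \<bar>r * x i\<bar> < \<epsilon>)"
    using J(1) by blast
qed

instance
  by standard (unfold minus_c0_def, (transfer; auto simp: algebra_simps)+)

end

lemma c0_nth_simps [simp]:
  "c0_nth 0 i = 0"
  "c0_nth (- x) i = - c0_nth x i"
  "c0_nth (x + y) i = c0_nth x i + c0_nth y i"
  "c0_nth (x - y) i = c0_nth x i - c0_nth y i"
  "c0_nth (r *\<^sub>R x) i = r * c0_nth x i"
  unfolding minus_c0_def by (transfer; simp)+

instantiation c0 :: (type) real_normed_vector
begin

definition norm_c0 :: "'a c0 \<Rightarrow> real" where
  "norm_c0 x = (SUP i. \<bar>c0_nth x i\<bar>)"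

definition dist_c0 :: "'a c0 \<Rightarrow> 'a c0 \<Rightarrow> real" where
  "dist_c0 x y = norm (x - y)"

definition sgn_c0 :: "'a c0 \<Rightarrow> 'a c0" where
  "sgn_c0 x = x /\<^sub>R norm x"

definition uniformity_c0 :: "('a c0 \<times> 'a c0) filter" where
  "uniformity_c0 = (INF e\<in>{0<..}. principal {(x, y). dist x y < e})"

definition open_c0 :: "'a c0 set \<Rightarrow> bool" where
  "open_c0 U = (\<forall>x\<in>U. \<forall>\<^sub>F (x', y) in uniformity. x' = x \<longrightarrow> y \<in> U)"

lemma abs_c0_nth_le_norm: "\<bar>c0_nth x i\<bar> \<le> norm (x :: 'a c0)"
  unfolding norm_c0_def by (rule cSUP_upper[OF UNIV_I c0_bdd_above])

lemma c0_norm_le: "(\<And>i. \<bar>c0_nth x i\<bar> \<le> C) \<Longrightarrow> norm (x :: 'a c0) \<le> C"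
  unfolding norm_c0_def by (rule cSUP_least) auto

instance
proof
  fix x y :: "'a c0" and r :: real
  show "norm x = 0 \<longleftrightarrow> x = 0"
  proof
    assume "norm x = 0"
    then show "x = 0"
      using abs_c0_nth_le_norm[of x] by (intro c0_eqI) auto
  qed (simp add: norm_c0_def)
  show "norm (x + y) \<le> norm x + norm y"
  proof (rule c0_norm_le)
    fix i
    show "\<bar>c0_nth (x + y) i\<bar> \<le> norm x + norm y"
      using abs_c0_nth_le_norm[of x i] abs_c0_nth_le_norm[of y i] by simp
  qed
  have le: "norm (s *\<^sub>R z) \<le> \<bar>s\<bar> * norm z" for s and z :: "'a c0"
    by (rule c0_norm_le) (simp add: abs_mult mult_left_mono abs_c0_nth_le_norm)
  show "norm (r *\<^sub>R x) = \<bar>r\<bar> * norm x"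
  proof (cases "r = 0")
    case True
    then show ?thesis by (simp add: norm_c0_def)
  next
    case False
    have "\<bar>r\<bar> * norm x = \<bar>r\<bar> * norm (inverse r *\<^sub>R (r *\<^sub>R x))"
      using False by simp
    also have "\<dots> \<le> \<bar>r\<bar> * (\<bar>inverse r\<bar> * norm (r *\<^sub>R x))"
      using le[of "inverse r" "r *\<^sub>R x"] by (intro mult_left_mono) auto
    also have "\<dots> = norm (r *\<^sub>R x)"
      using False by (simp add: abs_inverse)
    finally show ?thesis
      using le[of r x] by linarith
  qed
qed (simp_all add: dist_c0_def sgn_c0_def uniformity_c0_def open_c0_def)

end

instance c0 :: (type) banach
proof
  fix X :: "nat \<Rightarrow> 'a c0"
  assume X: "Cauchy X"
  have "Cauchy (\<lambda>n. c0_nth (X n) i)" for i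
  proof (rule metric_CauchyI)
    fix e :: real assume "0 < e"
    then obtain N where N: "\<And>m n. m \<ge> N \<Longrightarrow> n \<ge> N \<Longrightarrow> dist (X m) (X n) < e"
      using metric_CauchyD[OF X] by metis
    have "dist (c0_nth (X m) i) (c0_nth (X n) i) \<le> dist (X m) (X n)" for m n
      using abs_c0_nth_le_norm[of "X m - X n" i] by (simp add: dist_c0_def dist_real_def)
    then show "\<exists>M. \<forall>m\<ge>M. \<forall>n\<ge>M. dist (c0_nth (X m) i) (c0_nth (X n) i) < e"
      using N by (intro exI[of _ N] allI impI) (rule le_less_trans)
  qed
  then have "\<forall>i. \<exists>l. (\<lambda>n. c0_nth (X n) i) \<longlonglongrightarrow> l"
    by (simp add: Cauchy_convergent_iff convergent_def)
  then obtain L where L: "\<And>i. (\<lambda>n. c0_nth (X n) i) \<longlonglongrightarrow> L i"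
    by metis
  have close: "\<exists>N. \<forall>n\<ge>N. \<forall>i. \<bar>c0_nth (X n) i - L i\<bar> \<le> e" if e: "0 < e" for e
  proof -
    obtain N where N: "\<And>m n. m \<ge> N \<Longrightarrow> n \<ge> N \<Longrightarrow> dist (X m) (X n) < e"
      using metric_CauchyD[OF X e] by metis
    have "\<bar>c0_nth (X n) i - L i\<bar> \<le> e" if n: "n \<ge> N" for n i
    proof (rule tendsto_upperbound)
      show "(\<lambda>m. \<bar>c0_nth (X n) i - c0_nth (X m) i\<bar>) \<longlonglongrightarrow> \<bar>c0_nth (X n) i - L i\<bar>"
        by (intro tendsto_intros L)
      show "\<forall>\<^sub>F m in sequentially. \<bar>c0_nth (X n) i - c0_nth (X m) i\<bar> \<le> e"
        using eventually_ge_at_top[of N]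
      proof eventually_elim
        case (elim m)
        then show ?case
          using abs_c0_nth_le_norm[of "X n - X m" i] N[OF n elim] by (simp add: dist_c0_def)
      qed
    qed simp
    then show ?thesis by blast
  qed
  have "\<exists>J. finite J \<and> (\<forall>i\<in>- J. \<bar>L i\<bar> < e)" if e: "0 < e" for e
  proof -
    obtain N where N: "\<And>n i. n \<ge> N \<Longrightarrow> \<bar>c0_nth (X n) i - L i\<bar> \<le> e / 2"
      using close[of "e / 2"] e by auto
    obtain J where J: "finite J" "\<And>i. i \<notin> J \<Longrightarrow> \<bar>c0_nth (X N) i\<bar> < e / 2"
      using c0_small[of "e / 2" "X N"] e by auto
    have "\<bar>L i\<bar> < e" if "i \<in> - J" for i
    proof -
      have "\<bar>c0_nth (X N) i\<bar> < e / 2" "\<bar>c0_nth (X N) i - L i\<bar> \<le> e / 2"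
        using J(2) N that by auto
      then show ?thesis by linarith
    qed
    then show ?thesis
      using J(1) by blast
  qed
  then have nth: "c0_nth (Abs_c0 L) = L"
    by (intro Abs_c0_inverse) auto
  have "X \<longlonglongrightarrow> Abs_c0 L"
  proof (rule metric_LIMSEQ_I)
    fix e :: real assume e: "0 < e"
    obtain N where N: "\<And>n i. n \<ge> N \<Longrightarrow> \<bar>c0_nth (X n) i - L i\<bar> \<le> e / 2"
      using close[of "e / 2"] e by auto
    have "dist (X n) (Abs_c0 L) < e" if "n \<ge> N" for n
    proof -
      have "norm (X n - Abs_c0 L) \<le> e / 2"
        by (rule c0_norm_le) (use N[OF that] in \<open>simp add: nth\<close>)
      then show ?thesis
        using e by (simp add: dist_c0_def)
    qed
    then show "\<exists>N. \<forall>n\<ge>N. dist (X n) (Abs_c0 L) < e"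
      by blast
  qed
  then show "convergent X"
    by (rule convergentI)
qed


section \<open>Weighted pseudo-shifts and frequent universality\<close>

definition weighted_pseudo_shift ::
    "('i \<Rightarrow> real) \<Rightarrow> ('i \<Rightarrow> 'i) \<Rightarrow> ('i c0 \<Rightarrow> 'i c0) \<Rightarrow> bool" where
  "weighted_pseudo_shift b \<phi> T \<longleftrightarrow>
     bounded_linear T \<and> (\<forall>i. b i \<noteq> 0) \<and> inj \<phi> \<and>
     (\<forall>x i. c0_nth (T x) i = b i * c0_nth x (\<phi> i))"

text \<open>
  Sequences and sets of indices start at 1: a sequence is a function on \<^typ>\<open>nat\<close> whose value
  at 0 is irrelevant, and 0 never counts towards a density.
\<close>

definition lower_density :: "nat set \<Rightarrow> ereal" where
  "lower_density A = liminf (\<lambda>N. ereal (real (card {n \<in> A. 1 \<le> n \<and> n \<le> N}) / real N))"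

definition frequently_universal ::
    "(nat \<Rightarrow> 'a::topological_space \<Rightarrow> 'b::topological_space) \<Rightarrow> bool" where
  "frequently_universal T \<longleftrightarrow>
     (\<exists>x. \<forall>U. open U \<and> U \<noteq> {} \<longrightarrow> lower_density {n. 1 \<le> n \<and> T n x \<in> U} > 0)"

definition run_away :: "(nat \<Rightarrow> 'i \<Rightarrow> 'i) \<Rightarrow> bool" where
  "run_away \<phi> \<longleftrightarrow>
     (\<forall>I\<^sub>0 J\<^sub>0. finite I\<^sub>0 \<and> finite J\<^sub>0 \<longrightarrow>
        (\<exists>n\<^sub>0\<ge>1. \<forall>n\<ge>n\<^sub>0. \<phi> n ` J\<^sub>0 \<inter> I\<^sub>0 = {}))"

definition positive_divergent :: "(nat \<Rightarrow> real) \<Rightarrow> bool" where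
  "positive_divergent M \<longleftrightarrow> (\<forall>p\<ge>1. 0 < M p) \<and> filterlim M at_top sequentially"

definition separating_sets ::
    "(nat \<Rightarrow> 'i \<Rightarrow> real) \<Rightarrow> (nat \<Rightarrow> 'i \<Rightarrow> 'i) \<Rightarrow> (nat \<Rightarrow> 'i set) \<Rightarrow> (nat \<Rightarrow> real) \<Rightarrow>
      (nat \<Rightarrow> nat set) \<Rightarrow> bool" where
  "separating_sets b \<phi> W M E \<longleftrightarrow>
     (\<forall>p\<ge>1. E p \<subseteq> {1..}) \<and>
     (\<forall>p\<ge>1. lower_density (E p) > 0) \<and>
     (\<forall>p\<ge>1. \<forall>q\<ge>1. p \<noteq> q \<longrightarrow>
        (\<forall>n\<in>E p. \<forall>m\<in>E q. \<phi> n ` W p \<inter> \<phi> m ` W q = {})) \<and>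
     (\<forall>p\<ge>1. \<forall>s\<in>W p.
        filterlim (\<lambda>n. b n s) at_top (inf sequentially (principal (E p)))) \<and>
     (\<forall>p\<ge>1. \<forall>q\<ge>1. \<forall>n\<in>E p. \<forall>m\<in>E q. n \<noteq> m \<longrightarrow>
        (\<forall>t\<in>W q. \<forall>s. \<phi> n s = \<phi> m t \<longrightarrow> b n s / b m t \<le> 1 / (M p * M q)))"

end

theory Submission
  imports Defs
begin

text \<open>
  Necessity: for a frequently universal vector \<open>x\<close>, the set \<open>E p\<close> consists of times \<open>n\<close> at which
  \<open>T n x\<close> is very close to the vector with constant value \<open>c p\<close> on \<open>W p\<close> and 0 elsewhere. The values
  \<open>c p\<close> grow so fast that an overlap of \<open>\<phi> n ` W p\<close> with \<open>\<phi> m ` W q\<close> for \<open>p \<noteq> q\<close> would contradict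
  the ratio condition, the distance of \<open>n\<close> and \<open>m\<close> being controlled by \<open>g\<close>. Overlaps for \<open>p = q\<close> are
  avoided by thinning out the set of times.

  Sufficiency: take a dense sequence \<open>y\<close> of finitely supported vectors with \<open>y p\<close> supported in \<open>W p\<close>
  and bounded by \<open>M p\<close>, and put \<open>x (\<phi> n s) = y p s / b n s\<close> for \<open>n \<in> E p\<close> and \<open>s \<in> W p\<close>. Conditions
  (b) and (d) make this well defined, (c) gives a null family, and by (d) the distance of \<open>T n x\<close>
  from \<open>y p\<close> is at most \<open>1 / M p\<close>.
\<close>

subsection \<open>Lower density\<close>

text \<open>Trades the liminf for an eventual linear lower bound on the counting function, the form
  in which sets are compared below.\<close>

lemma lower_density_pos_iff:
  "lower_density A > 0 \<longleftrightarrow>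
     (\<exists>c>0. \<forall>\<^sub>F N in sequentially. c * real N \<le> real (card {n \<in> A. 1 \<le> n \<and> n \<le> N}))"
  (is "_ \<longleftrightarrow> (\<exists>c>0. \<forall>\<^sub>F N in sequentially. c * real N \<le> real (?card N))")
proof
  assume "lower_density A > 0"
  then obtain c where c: "0 < ereal c" "ereal c < lower_density A"
    using ereal_dense2 by blast
  have "\<forall>\<^sub>F N in sequentially. ereal c < ereal (real (?card N) / real N)"
    using c(2) unfolding lower_density_def by (rule less_LiminfD)
  then have "\<forall>\<^sub>F N in sequentially. c * real N \<le> real (?card N)"
    using eventually_gt_at_top[of 0]
  proof eventually_elim
    case (elim N)
    then show ?case
      by (simp add: field_simps)
  qed
  with c(1) show "\<exists>c>0. \<forall>\<^sub>F N in sequentially. c * real N \<le> real (?card N)"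
    by auto
next
  assume "\<exists>c>0. \<forall>\<^sub>F N in sequentially. c * real N \<le> real (?card N)"
  then obtain c where c: "c > 0" "\<forall>\<^sub>F N in sequentially. c * real N \<le> real (?card N)"
    by auto
  have "\<forall>\<^sub>F N in sequentially. ereal c \<le> ereal (real (?card N) / real N)"
    using c(2) eventually_gt_at_top[of 0] by eventually_elim (simp add: field_simps)
  then have "ereal c \<le> lower_density A"
    unfolding lower_density_def by (rule Liminf_bounded)
  with c(1) show "lower_density A > 0"
    by (meson ereal_less(2) less_le_trans)
qed

text \<open>Linear growth survives division by \<open>d\<close>, and the constant \<open>e\<close>
  is eventually absorbed. The case \<open>d = 1\<close> serves for discarding finitely many
  elements, the case \<open>d = K\<close> for thinning.\<close>

lemma lower_density_pos_if_linear_bound: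
  assumes A: "lower_density A > 0" and d: "d > 0"
    and le: "\<And>N. real (card {n \<in> A. 1 \<le> n \<and> n \<le> N}) \<le> d * (real (card {n \<in> B. 1 \<le> n \<and> n \<le> N}) + e)"
  shows "lower_density B > 0"
proof -
  obtain c where c: "c > 0"
    "\<forall>\<^sub>F N in sequentially. c * real N \<le> real (card {n \<in> A. 1 \<le> n \<and> n \<le> N})"
    using A lower_density_pos_iff by auto
  \<comment> \<open>Beyond \<open>2 * d * e / c\<close> the error \<open>d * e\<close> is at most
    half of \<open>c * N\<close>; this costs the factor 2 in the new constant.\<close>
  have "\<forall>\<^sub>F N in sequentially. c / (2 * d) * real N \<le> real (card {n \<in> B. 1 \<le> n \<and> n \<le> N})"
    using c(2) eventually_ge_at_top[of "nat \<lceil>2 * d * e / c\<rceil>"]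
  proof eventually_elim
    case (elim N)
    then have "2 * d * e / c \<le> real N"
      by linarith
    then have "2 * (d * e) \<le> c * real N"
      using c(1) by (simp add: field_simps)
    moreover have "c * real N \<le> d * real (card {n \<in> B. 1 \<le> n \<and> n \<le> N}) + d * e"
      using elim(1) le[of N] by (simp add: algebra_simps)
    ultimately have "c * real N \<le> 2 * (d * real (card {n \<in> B. 1 \<le> n \<and> n \<le> N}))"
      by linarith
    then show ?case
      using d by (simp add: field_simps)
  qed
  then show ?thesis
    using c(1) d unfolding lower_density_pos_iff by (intro exI[of _ "c / (2 * d)"]) simp
qed

lemma lower_density_pos_diff_finite:
  assumes "lower_density A > 0" and fin: "finite (A - B)"
  shows "lower_density B > 0"
proof (rule lower_density_pos_if_linear_bound[OF assms(1), of 1 _ "real (card (A - B))"])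
  fix N
  have "card {n \<in> A. 1 \<le> n \<and> n \<le> N} \<le> card ({n \<in> B. 1 \<le> n \<and> n \<le> N} \<union> (A - B))"
    using fin by (intro card_mono) auto
  also have "\<dots> \<le> card {n \<in> B. 1 \<le> n \<and> n \<le> N} + card (A - B)"
    by (rule card_Un_le)
  finally show "real (card {n \<in> A. 1 \<le> n \<and> n \<le> N}) \<le>
      1 * (real (card {n \<in> B. 1 \<le> n \<and> n \<le> N}) + real (card (A - B)))"
    by (simp flip: of_nat_add)
qed simp

text \<open>Keep the elements of \<open>A\<close> whose rank in \<open>A\<close> is a multiple of
  \<open>K\<close>. The rank grows by at most 1 per step, so kept elements lie at least
  \<open>K\<close> apart, and about one element in \<open>K\<close> remains.\<close>

lemma lower_density_pos_thin:
  assumes A: "lower_density A > 0" and K: "K > 0"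
  obtains B where "B \<subseteq> A" "lower_density B > 0"
    "\<And>m n. m \<in> B \<Longrightarrow> n \<in> B \<Longrightarrow> m < n \<Longrightarrow> m + K \<le> n"
proof
  define r where "r n = card {j \<in> A. 1 \<le> j \<and> j \<le> n}" for n
  define B where "B = {n \<in> A. K dvd r n}"
  show "B \<subseteq> A"
    by (auto simp: B_def)
  have r_Suc: "r (Suc n) = (if Suc n \<in> A then Suc (r n) else r n)" for n
  proof -
    have "{j \<in> A. 1 \<le> j \<and> j \<le> Suc n} =
        (if Suc n \<in> A then insert (Suc n) {j \<in> A. 1 \<le> j \<and> j \<le> n} else {j \<in> A. 1 \<le> j \<and> j \<le> n})"
      by (auto simp: le_Suc_eq)
    then show ?thesis
      by (simp add: r_def)
  qed
  have card_B: "card {n \<in> B. 1 \<le> n \<and> n \<le> N} = r N div K" for N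
  proof (induction N)
    case 0
    have "{n \<in> C. 1 \<le> n \<and> n \<le> 0} = {}" for C :: "nat set"
      by auto
    then show ?case
      by (simp only: r_def card.empty div_0)
  next
    case (Suc N)
    have "{n \<in> B. 1 \<le> n \<and> n \<le> Suc N} =
        (if Suc N \<in> B then insert (Suc N) {n \<in> B. 1 \<le> n \<and> n \<le> N} else {n \<in> B. 1 \<le> n \<and> n \<le> N})"
      by (auto simp: le_Suc_eq)
    with Suc show ?case
      by (auto simp: B_def r_Suc div_Suc dvd_eq_mod_eq_0)
  qed
  show "lower_density B > 0"
  proof (rule lower_density_pos_if_linear_bound[OF A])
    show "real K > 0"
      using K by simp
    fix N
    have "r N \<le> K * (r N div K + 1)"
      using K by (metis add.commute dividend_less_times_div less_imp_le mult_Suc_right plus_1_eq_Suc)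
    then have "real (r N) \<le> real K * (real (r N div K) + 1)"
      by (metis of_nat_1 of_nat_add of_nat_le_iff of_nat_mult)
    then show "real (card {n \<in> A. 1 \<le> n \<and> n \<le> N}) \<le>
        real K * (real (card {n \<in> B. 1 \<le> n \<and> n \<le> N}) + 1)"
      unfolding card_B by (simp only: r_def)
  qed
  fix m n assume mn: "m \<in> B" "n \<in> B" "m < n"
  have growth: "r m \<le> r (m + d) \<and> r (m + d) \<le> r m + d" for d
    by (induction d) (auto simp: r_Suc)
  \<comment> \<open>Strict, because \<open>n\<close> itself lies in \<open>A\<close> and raises the
    rank.\<close>
  have "r m < r n"
  proof -
    obtain d where d: "n = Suc (m + d)"
      using mn(3) less_imp_Suc_add by auto
    then show ?thesis
      using growth[of d] mn(2) by (simp add: r_Suc B_def)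
  qed
  moreover have "K dvd r m" "K dvd r n"
    using mn by (auto simp: B_def)
  ultimately have "K \<le> r n - r m"
    by (intro dvd_imp_le) auto
  also have "r n \<le> r m + (n - m)"
    using growth[of "n - m"] mn(3) by simp
  finally show "m + K \<le> n"
    using \<open>r m < r n\<close> mn(3) by linarith
qed

subsection \<open>Finitely supported vectors\<close>

lemma c0_nth_Abs_c0_finite:
  assumes "finite J" "\<And>i. i \<notin> J \<Longrightarrow> f i = 0"
  shows "c0_nth (Abs_c0 f) = f"
  using assms by (intro Abs_c0_inverse) auto

text \<open>Association lists with rational values encode the finitely supported rational vectors
  and form a countable type. Infinite repetition lets an approximant be met at an index
  \<open>p\<close> so large that \<open>W p\<close> contains its support and \<open>M p\<close>
  exceeds its norm.\<close>

lemma ex_dense_finitely_supported_c0: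
  obtains z :: "nat \<Rightarrow> 'i::countable c0"
  where "\<And>k. finite {i. c0_nth (z k) i \<noteq> 0}"
    and "\<And>u e. e > 0 \<Longrightarrow> \<exists>w. norm (w - u) < e \<and> (\<exists>\<^sub>\<infinity>k. z k = w)"
proof
  define v :: "('i \<times> rat) list \<Rightarrow> 'i \<Rightarrow> real" where
    "v l i = (case map_of l i of None \<Rightarrow> 0 | Some q \<Rightarrow> of_rat q)" for l i
  \<comment> \<open>The first component only serves to repeat every vector infinitely often.\<close>
  define z :: "nat \<Rightarrow> 'i c0" where "z k = Abs_c0 (v (snd (from_nat k :: nat \<times> _)))" for k
  have v0: "v l i = 0" if "i \<notin> fst ` set l" for l i
  proof -
    have "map_of l i = None"
      using that by (simp add: map_of_eq_None_iff)
    then show ?thesis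
      by (simp add: v_def)
  qed
  have nth: "c0_nth (Abs_c0 (v l)) = v l" for l
    by (rule c0_nth_Abs_c0_finite[of "fst ` set l"]) (auto intro: v0)
  show "finite {i. c0_nth (z k) i \<noteq> 0}" for k
    unfolding z_def nth
    by (rule finite_subset[of _ "fst ` set (snd (from_nat k :: nat \<times> ('i \<times> rat) list))"])
      (use v0 in blast, simp)
  fix u :: "'i c0" and e :: real
  assume e: "e > 0"
  obtain J where J: "finite J" "\<And>i. i \<notin> J \<Longrightarrow> \<bar>c0_nth u i\<bar> < e / 2"
    using c0_small[of "e / 2" u] e by auto
  have "\<exists>q. \<bar>of_rat q - c0_nth u i\<bar> < e / 2" for i
  proof -
    obtain q where "c0_nth u i < of_rat q" "of_rat q < c0_nth u i + e / 2"
      using of_rat_dense[of "c0_nth u i" "c0_nth u i + e / 2"] e by auto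
    then show ?thesis
      by (intro exI[of _ q]) auto
  qed
  then obtain q where q: "\<And>i. \<bar>of_rat (q i) - c0_nth u i\<bar> < e / 2"
    by metis
  obtain xs where xs: "set xs = J"
    using finite_list[OF J(1)] by auto
  define l where "l = map (\<lambda>i. (i, q i)) xs"
  have vl: "v l i = (if i \<in> J then of_rat (q i) else 0)" for i
    by (simp add: v_def l_def map_of_map_restrict restrict_map_def xs)
  have "norm (Abs_c0 (v l) - u) \<le> e / 2"
    by (rule c0_norm_le) (use q J(2) in \<open>auto simp: nth vl less_imp_le\<close>)
  then have close: "norm (Abs_c0 (v l) - u) < e"
    using e by simp
  have "inj (\<lambda>j::nat. to_nat (j, l))"
    by (auto simp: inj_on_def)
  then have "infinite (range (\<lambda>j::nat. to_nat (j, l)))"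
    by (simp add: finite_image_iff)
  moreover have "range (\<lambda>j::nat. to_nat (j, l)) \<subseteq> {k. z k = Abs_c0 (v l)}"
    by (auto simp: z_def)
  ultimately have "\<exists>\<^sub>\<infinity>k. z k = Abs_c0 (v l)"
    unfolding INFM_iff_infinite by (meson finite_subset)
  then show "\<exists>w. norm (w - u) < e \<and> (\<exists>\<^sub>\<infinity>k. z k = w)"
    using close by blast
qed

section \<open>Entries along the sequence, and exhaustion by the sets \<open>W p\<close>\<close>

lemma weighted_pseudo_shift_nth:
  "weighted_pseudo_shift b \<phi> T \<Longrightarrow> c0_nth (T x) i = b i * c0_nth x (\<phi> i)"
  by (simp add: weighted_pseudo_shift_def)

text \<open>Off a finite set the entries of \<open>x\<close> are small, and
  \<open>\<phi> n s\<close> eventually leaves that set for good.\<close>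

lemma nth_run_away_tendsto_0:
  assumes "run_away \<phi>"
  shows "(\<lambda>n. c0_nth x (\<phi> n s)) \<longlonglongrightarrow> 0"
proof (rule LIMSEQ_I)
  fix e :: real assume "e > 0"
  then obtain J where J: "finite J" "\<And>i. i \<notin> J \<Longrightarrow> \<bar>c0_nth x i\<bar> < e"
    using c0_small by blast
  obtain n0 where n0: "\<And>n. n \<ge> n0 \<Longrightarrow> \<phi> n ` {s} \<inter> J = {}"
    using assms J(1) unfolding run_away_def by (meson finite.emptyI finite.insertI)
  show "\<exists>n0. \<forall>n\<ge>n0. norm (c0_nth x (\<phi> n s) - 0) < e"
    using n0 J(2) by (intro exI[of _ n0]) auto
qed

lemma finite_sublevel_if_filterlim_at_top:
  fixes f :: "nat \<Rightarrow> real"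
  assumes "filterlim f at_top (inf sequentially (principal E))"
  shows "finite {n \<in> E. f n \<le> C}"
proof -
  have "\<forall>\<^sub>F n in inf sequentially (principal E). C < f n"
    using assms unfolding filterlim_at_top_dense by blast
  then obtain N where "\<And>n. n \<ge> N \<Longrightarrow> n \<in> E \<Longrightarrow> C < f n"
    unfolding eventually_inf_principal eventually_sequentially by auto
  then have "{n \<in> E. f n \<le> C} \<subseteq> {..<N}"
    by (auto simp: not_le[symmetric])
  then show ?thesis
    by (rule finite_subset) simp
qed

lemma mono_from_one:
  assumes "\<And>p. p \<ge> 1 \<Longrightarrow> W p \<subseteq> W (Suc p)" "1 \<le> p" "p \<le> q"
  shows "W p \<subseteq> W q"
  using assms(3) by (induction q rule: dec_induct) (use assms(1,2) in \<open>auto dest: order_trans\<close>)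

lemma finite_subset_exhaustion:
  assumes mono: "\<And>p. p \<ge> 1 \<Longrightarrow> W p \<subseteq> W (Suc p)" and ex: "(\<Union>p\<in>{1..}. W p) = UNIV"
    and "finite J"
  obtains P where "P \<ge> 1" "\<And>p. p \<ge> P \<Longrightarrow> J \<subseteq> W p"
proof -
  have "\<exists>P\<ge>1. J \<subseteq> W P"
    using \<open>finite J\<close>
  proof (induction J)
    case empty
    then show ?case by auto
  next
    case (insert j J)
    then obtain P where P: "P \<ge> 1" "J \<subseteq> W P"
      by auto
    obtain Q where Q: "Q \<ge> 1" "j \<in> W Q"
      using ex by auto
    have "W P \<subseteq> W (max P Q)" "W Q \<subseteq> W (max P Q)"
      using P(1) Q(1) by (simp_all add: mono_from_one[of W, OF mono])
    then show ?case
      using P Q by (intro exI[of _ "max P Q"]) auto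
  qed
  then obtain P where P: "P \<ge> 1" "J \<subseteq> W P"
    by auto
  then show ?thesis
    using that[of P] mono_from_one[of W, OF mono P(1)] by blast
qed

subsection \<open>Necessity\<close>

text \<open>The recursion only compares \<open>c (Suc p)\<close> with \<open>c p\<close>. Since
  \<open>R \<ge> 1\<close> and \<open>c \<ge> 0\<close> make \<open>c\<close> increasing, the bound
  passes to all earlier \<open>c q\<close>. Both summands 1 leave room for approximation
  errors.\<close>

lemma ex_fast_growing:
  fixes L R :: "nat \<Rightarrow> real"
  assumes R: "\<And>p. R p \<ge> 1" and L: "\<And>p. L p \<ge> 0"
  obtains c where "\<And>p. c p \<ge> L p" "\<And>p q. q < p \<Longrightarrow> R p * (c q + 1) + 1 < c p"
proof -
  have "\<exists>c. \<forall>p. c p \<ge> L p \<and> R (Suc p) * (c p + 1) + 1 < c (Suc p)"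
  proof (rule dependent_nat_choice)
    show "\<exists>y. y \<ge> L (Suc p) \<and> R (Suc p) * (x + 1) + 1 < y" for x p
      by (rule exI[of _ "max (L (Suc p)) (R (Suc p) * (x + 1) + 2)"]) auto
  qed auto
  then obtain c where c: "\<And>p. c p \<ge> L p" "\<And>p. R (Suc p) * (c p + 1) + 1 < c (Suc p)"
    by auto
  have c0: "c p \<ge> 0" for p
    using c(1)[of p] L[of p] by linarith
  have "c p \<le> c (Suc p)" for p
  proof -
    have "c p \<le> 1 * (c p + 1)"
      by simp
    also have "\<dots> \<le> R (Suc p) * (c p + 1)"
      using R[of "Suc p"] c0[of p] by (intro mult_right_mono) auto
    also have "\<dots> \<le> c (Suc p)"
      using less_imp_le[OF c(2)[of p]] by (rule order_trans[rotated]) simp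
    finally show ?thesis .
  qed
  then have mono: "c q \<le> c p" if "q \<le> p" for p q
    using that by (rule lift_Suc_mono_le)
  show ?thesis
  proof
    show "R p * (c q + 1) + 1 < c p" if "q < p" for p q
    proof -
      have k: "p = Suc (p - 1)" "q \<le> p - 1"
        using that by auto
      have "R p * (c q + 1) \<le> R p * (c (p - 1) + 1)"
        using R[of p] mono[OF k(2)] by (intro mult_left_mono) auto
      then show ?thesis
        using c(2)[of "p - 1"] k(1) by auto
    qed
  qed (rule c(1))
qed

text \<open>\<open>M\<close> is prescribed and \<open>E\<close> is built for it, so this yields both
  forms of the necessary condition.\<close>

lemma separating_sets_if_frequently_universal:
  fixes T :: "nat \<Rightarrow> 'i c0 \<Rightarrow> 'i c0" and g :: "'i \<Rightarrow> real"
  assumes shifts: "\<And>n. n \<ge> 1 \<Longrightarrow> weighted_pseudo_shift (b n) (\<phi> n) (T n)"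
    and b_pos: "\<And>n i. n \<ge> 1 \<Longrightarrow> b n i > 0"
    and run_away: "run_away \<phi>"
    and rho: "\<rho> > 1"
    and ratio: "\<And>n m s t. n \<ge> 1 \<Longrightarrow> m \<ge> 1 \<Longrightarrow> \<phi> n s = \<phi> m t \<Longrightarrow>
                  1 / \<rho> powr \<bar>real n - real m\<bar> \<le> b n s / b m t"
    and gap: "\<And>n m s t. n \<ge> 1 \<Longrightarrow> m \<ge> 1 \<Longrightarrow> \<phi> n s = \<phi> m t \<Longrightarrow>
                \<bar>real n - real m\<bar> \<le> \<bar>g s - g t\<bar>"
    and W_finite: "\<And>p. p \<ge> 1 \<Longrightarrow> finite (W p)"
    and W_mono: "\<And>p. p \<ge> 1 \<Longrightarrow> W p \<subseteq> W (Suc p)"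
    and M_pos: "\<And>p. p \<ge> 1 \<Longrightarrow> M p > 0"
    and fu: "frequently_universal T"
  obtains E where "separating_sets b \<phi> W M E"
proof -
  obtain x where x: "\<And>U. open U \<Longrightarrow> U \<noteq> {} \<Longrightarrow> lower_density {n. 1 \<le> n \<and> T n x \<in> U} > 0"
    using fu unfolding frequently_universal_def by blast
  \<comment> \<open>By \<open>gap\<close>, two times at which images of points of \<open>W p\<close>
    coincide differ by at most \<open>D p\<close>.\<close>
  have "\<exists>D\<ge>0. p \<ge> 1 \<longrightarrow> (\<forall>s\<in>W p. \<forall>t\<in>W p. \<bar>g s - g t\<bar> \<le> D)" for p
  proof (cases "p \<ge> 1")
    case True
    then have "finite ((\<lambda>(s, t). \<bar>g s - g t\<bar>) ` (W p \<times> W p))"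
      using W_finite by simp
    then have "bdd_above ((\<lambda>(s, t). \<bar>g s - g t\<bar>) ` (W p \<times> W p))"
      by (rule bdd_above_finite)
    then obtain D where "\<And>s t. s \<in> W p \<Longrightarrow> t \<in> W p \<Longrightarrow> \<bar>g s - g t\<bar> \<le> D"
      unfolding bdd_above_def by force
    then show ?thesis
      by (intro exI[of _ "max D 0"]) (auto simp: le_max_iff_disj)
  qed auto
  then obtain D where D: "\<And>p. D p \<ge> 0"
    "\<And>p s t. p \<ge> 1 \<Longrightarrow> s \<in> W p \<Longrightarrow> t \<in> W p \<Longrightarrow> \<bar>g s - g t\<bar> \<le> D p"
    by metis
  obtain c where c_ge: "\<And>p. c p \<ge> \<bar>M p\<bar> + 1"
    and c_grow: "\<And>p q. q < p \<Longrightarrow> \<rho> powr D p * (c q + 1) + 1 < c p"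
    using ex_fast_growing[of "\<lambda>p. \<rho> powr D p" "\<lambda>p. \<bar>M p\<bar> + 1"] rho D(1)
    by (auto simp: ge_one_powr_ge_zero)
  define y where "y p = Abs_c0 (\<lambda>i. if i \<in> W p then c p else 0)" for p
  have y: "c0_nth (y p) i = (if i \<in> W p then c p else 0)" if "p \<ge> 1" for p i
    unfolding y_def using W_finite[OF that] by (subst c0_nth_Abs_c0_finite) auto
  \<comment> \<open>The bound 1 keeps the entries on \<open>W p\<close> within one unit of
    \<open>c p\<close>; the bound \<open>1 / M p\<close> makes the entries off \<open>W p\<close>
    small enough for (d).\<close>
  define \<epsilon> where "\<epsilon> p = min 1 (1 / M p)" for p
  \<comment> \<open>The integer \<open>nat (\<lfloor>D p\<rfloor> + 1)\<close> is larger than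
    \<open>D p\<close>, so distinct times in one thinned set are too far apart for an overlap on
    \<open>W p\<close>.\<close>
  have "\<exists>B. p \<ge> 1 \<longrightarrow> B \<subseteq> {n. 1 \<le> n \<and> T n x \<in> ball (y p) (\<epsilon> p)} \<and> lower_density B > 0 \<and>
      (\<forall>m\<in>B. \<forall>n\<in>B. m < n \<longrightarrow> m + nat (\<lfloor>D p\<rfloor> + 1) \<le> n)" for p
  proof (cases "p \<ge> 1")
    case True
    then have "\<epsilon> p > 0"
      using M_pos by (simp add: \<epsilon>_def)
    then have "lower_density {n. 1 \<le> n \<and> T n x \<in> ball (y p) (\<epsilon> p)} > 0"
      by (intro x) auto
    moreover have "nat (\<lfloor>D p\<rfloor> + 1) > 0"
      using D(1)[of p] by simp
    ultimately show ?thesis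
      by (rule lower_density_pos_thin) blast
  qed auto
  then obtain E where E: "\<And>p. p \<ge> 1 \<Longrightarrow> E p \<subseteq> {n. 1 \<le> n \<and> T n x \<in> ball (y p) (\<epsilon> p)}"
    "\<And>p. p \<ge> 1 \<Longrightarrow> lower_density (E p) > 0"
    "\<And>p m n. p \<ge> 1 \<Longrightarrow> m \<in> E p \<Longrightarrow> n \<in> E p \<Longrightarrow> m < n \<Longrightarrow> m + nat (\<lfloor>D p\<rfloor> + 1) \<le> n"
    by metis
  have E1: "n \<ge> 1" if "p \<ge> 1" "n \<in> E p" for p n
    using E(1) that by auto
  have close: "\<bar>b n s * c0_nth x (\<phi> n s) - (if s \<in> W p then c p else 0)\<bar> < \<epsilon> p"
    if "p \<ge> 1" "n \<in> E p" for p n s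
  proof -
    have "norm (y p - T n x) < \<epsilon> p"
      using E(1) that by (auto simp: dist_norm)
    then show ?thesis
      using abs_c0_nth_le_norm[of "y p - T n x" s] that
        weighted_pseudo_shift_nth[OF shifts[OF E1[OF that]], of x s] by (simp add: y)
  qed
  have near: "\<bar>b n s * c0_nth x (\<phi> n s) - c p\<bar> < 1" if "p \<ge> 1" "n \<in> E p" "s \<in> W p" for p n s
    using close[OF that(1,2), of s] that(3) by (simp add: \<epsilon>_def)
  have x_pos: "c0_nth x (\<phi> n s) > 0" if "p \<ge> 1" "n \<in> E p" "s \<in> W p" for p n s
  proof -
    have "b n s * c0_nth x (\<phi> n s) > 0"
      using near[OF that] c_ge[of p] by linarith
    then show ?thesis
      using b_pos[OF E1[OF that(1,2)], of s] by (simp add: zero_less_mult_iff)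
  qed
  have no_overlap: "\<phi> n s \<noteq> \<phi> m t"
    if q: "1 \<le> q" "q < p" and n: "n \<in> E p" "m \<in> E q" and s: "s \<in> W p" "t \<in> W q" for p q n m s t
  proof
    assume eq: "\<phi> n s = \<phi> m t"
    have p: "p \<ge> 1"
      using q by simp
    have n1: "n \<ge> 1" "m \<ge> 1"
      using E1[OF p n(1)] E1[OF q(1) n(2)] .
    \<comment> \<open>As \<open>q < p\<close>, both points lie in the larger set \<open>W p\<close>,
      and \<open>D p\<close> controls the time difference.\<close>
    have t: "t \<in> W p"
      using mono_from_one[of W, OF W_mono, of q p] q s(2) by auto
    define \<xi> where "\<xi> = c0_nth x (\<phi> n s)"
    have \<xi>: "\<xi> > 0" "b n s * \<xi> > c p - 1" "b m t * \<xi> < c q + 1"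
      using x_pos[OF p n(1) s(1)] near[OF p n(1) s(1)] near[OF q(1) n(2) s(2)] eq
      by (auto simp: \<xi>_def)
    have "\<bar>real n - real m\<bar> \<le> D p"
      using gap[OF n1 eq] D(2)[OF p s(1) t] by linarith
    \<comment> \<open>The ratio condition is used with the two pairs exchanged, to bound
      \<open>b n s\<close> from above.\<close>
    then have "1 / \<rho> powr D p \<le> 1 / \<rho> powr \<bar>real m - real n\<bar>"
      using rho by (intro divide_left_mono powr_mono) auto
    also have "\<dots> \<le> b m t / b n s"
      by (rule ratio[OF n1(2,1) eq[symmetric]])
    finally have "b n s \<le> \<rho> powr D p * b m t"
      using b_pos n1 rho by (simp add: field_simps)
    then have "b n s * \<xi> \<le> \<rho> powr D p * (b m t * \<xi>)"
      using \<xi>(1) by (simp add: mult_right_mono flip: mult.assoc)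
    also have "\<dots> \<le> \<rho> powr D p * (c q + 1)"
      using \<xi>(3) by (intro mult_left_mono) auto
    finally show False
      using \<xi>(2) c_grow[OF q(2)] by linarith
  qed
  have sep: "\<phi> n ` W p \<inter> \<phi> m ` W q = {}"
    if "p \<ge> 1" "q \<ge> 1" "p \<noteq> q" "n \<in> E p" "m \<in> E q" for p q n m
  proof (cases "q < p")
    case True
    then show ?thesis
      using no_overlap[of q p n m] that by auto
  next
    case False
    then show ?thesis
      using no_overlap[of p q m n] that by (metis (no_types, lifting) disjoint_iff imageE linorder_neqE_nat)
  qed
  have weights: "filterlim (\<lambda>n. b n s) at_top (inf sequentially (principal (E p)))"
    if p: "p \<ge> 1" "s \<in> W p" for p s
    unfolding filterlim_at_top_dense
  proof
    fix Z :: real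
    define Z' where "Z' = max Z 1"
    \<comment> \<open>The product of weight and entry stays above \<open>c p - 1 > 0\<close> on
      \<open>E p\<close> while the entry tends to 0, so the weight must diverge. Taking
      \<open>Z' \<ge> 1\<close> makes the quotient positive.\<close>
    have "\<forall>\<^sub>F n in sequentially. \<bar>c0_nth x (\<phi> n s)\<bar> < (c p - 1) / Z'"
    proof -
      have "c p - 1 > 0"
        using c_ge[of p] M_pos[OF p(1)] by linarith
      then have "(c p - 1) / Z' > 0"
        by (simp add: Z'_def)
      then show ?thesis
        using tendstoD[OF nth_run_away_tendsto_0[OF run_away]] by (simp add: dist_real_def)
    qed
    then show "\<forall>\<^sub>F n in inf sequentially (principal (E p)). Z < b n s"
      unfolding eventually_inf_principal
    proof eventually_elim
      case (elim n)
      show ?case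
      proof
        assume n: "n \<in> E p"
        have xi: "c0_nth x (\<phi> n s) > 0"
          by (rule x_pos[OF p(1) n p(2)])
        have "Z' * c0_nth x (\<phi> n s) < c p - 1"
          using elim xi by (simp add: Z'_def field_simps)
        also have "\<dots> < b n s * c0_nth x (\<phi> n s)"
          using near[OF p(1) n p(2)] by linarith
        finally have "Z' < b n s"
          using xi by simp
        then show "Z < b n s"
          by (simp add: Z'_def)
      qed
    qed
  qed
  have decay: "b n s / b m t \<le> 1 / (M p * M q)"
    if p: "p \<ge> 1" "q \<ge> 1" and n: "n \<in> E p" "m \<in> E q" "n \<noteq> m" and t: "t \<in> W q"
      and eq: "\<phi> n s = \<phi> m t" for p q n m s t
  proof -
    have n1: "n \<ge> 1" "m \<ge> 1"
      using E1[OF p(1) n(1)] E1[OF p(2) n(2)] .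
    \<comment> \<open>Otherwise two images overlap: \<open>sep\<close> excludes this for
      \<open>p \<noteq> q\<close>, the thinning for \<open>p = q\<close>.\<close>
    have s: "s \<notin> W p"
    proof
      assume s: "s \<in> W p"
      then have pq: "p = q"
        using sep[OF p _ n(1,2)] eq t by (metis disjoint_iff imageI)
      have "\<bar>real n - real m\<bar> \<le> D p"
        using gap[OF n1 eq] D(2)[OF p(1) s] t pq by force
      moreover have "m + nat (\<lfloor>D p\<rfloor> + 1) \<le> n \<or> n + nat (\<lfloor>D p\<rfloor> + 1) \<le> m"
        using E(3)[OF p(1)] n pq by (metis linorder_neqE_nat)
      ultimately show False
        using D(1)[of p] by linarith
    qed
    \<comment> \<open>The same entry of \<open>x\<close> is read at both times: scaled by
      \<open>b n s\<close> it is below \<open>1 / M p\<close>, scaled by \<open>b m t\<close> it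
      exceeds \<open>M q\<close>. The quotient of the readings is the quotient of the
      weights.\<close>
    define \<xi> where "\<xi> = c0_nth x (\<phi> n s)"
    have "\<bar>b n s * \<xi>\<bar> < 1 / M p"
      using close[OF p(1) n(1), of s] s by (simp add: \<xi>_def \<epsilon>_def)
    moreover have "\<xi> > 0" "b m t * \<xi> > M q"
      using x_pos[OF p(2) n(2) t] near[OF p(2) n(2) t] c_ge[of q] eq by (auto simp: \<xi>_def)
    ultimately have "(b n s * \<xi>) / (b m t * \<xi>) \<le> (1 / M p) / M q"
      using M_pos[OF p(1)] M_pos[OF p(2)] by (intro frac_le) auto
    then show ?thesis
      using \<open>\<xi> > 0\<close> by simp
  qed
  have "separating_sets b \<phi> W M E"
    unfolding separating_sets_def using E(2) E1 sep weights decay by auto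
  then show ?thesis
    by (rule that)
qed

subsection \<open>Sufficiency\<close>

lemma frequently_universal_if_separating_sets:
  fixes T :: "nat \<Rightarrow> 'i::countable c0 \<Rightarrow> 'i c0"
  assumes shifts: "\<And>n. n \<ge> 1 \<Longrightarrow> weighted_pseudo_shift (b n) (\<phi> n) (T n)"
    and b_pos: "\<And>n i. n \<ge> 1 \<Longrightarrow> b n i > 0"
    and W_finite: "\<And>p. p \<ge> 1 \<Longrightarrow> finite (W p)"
    and W_mono: "\<And>p. p \<ge> 1 \<Longrightarrow> W p \<subseteq> W (Suc p)"
    and W_exhausts: "(\<Union>p\<in>{1..}. W p) = UNIV"
    and M: "positive_divergent M"
    and E: "separating_sets b \<phi> W M E"
  shows "frequently_universal T"
proof -
  have E1: "\<And>p n. p \<ge> 1 \<Longrightarrow> n \<in> E p \<Longrightarrow> n \<ge> 1"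
    and dens: "\<And>p. p \<ge> 1 \<Longrightarrow> lower_density (E p) > 0"
    and sep: "\<And>p q n m. p \<ge> 1 \<Longrightarrow> q \<ge> 1 \<Longrightarrow> p \<noteq> q \<Longrightarrow> n \<in> E p \<Longrightarrow> m \<in> E q \<Longrightarrow>
      \<phi> n ` W p \<inter> \<phi> m ` W q = {}"
    and weights: "\<And>p s. p \<ge> 1 \<Longrightarrow> s \<in> W p \<Longrightarrow>
      filterlim (\<lambda>n. b n s) at_top (inf sequentially (principal (E p)))"
    and decay: "\<And>p q n m s t. p \<ge> 1 \<Longrightarrow> q \<ge> 1 \<Longrightarrow> n \<in> E p \<Longrightarrow> m \<in> E q \<Longrightarrow> n \<noteq> m \<Longrightarrow> t \<in> W q \<Longrightarrow>
      \<phi> n s = \<phi> m t \<Longrightarrow> b n s / b m t \<le> 1 / (M p * M q)"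
    using E unfolding separating_sets_def by (auto simp: subset_iff)
  have M_top: "filterlim M at_top sequentially"
    using M by (simp add: positive_divergent_def)
  have inj: "inj (\<phi> n)" if "n \<ge> 1" for n
    using shifts[OF that] by (simp add: weighted_pseudo_shift_def)
  have W_le: "W p \<subseteq> W q" if "1 \<le> p" "p \<le> q" for p q
    using mono_from_one[of W, OF W_mono that] .
  \<comment> \<open>The construction only uses indices from \<open>P0\<close> on:
    \<open>M p > 1\<close> gives injectivity of the positions, and \<open>W p \<noteq> {}\<close>
    gives disjointness of the sets of times.\<close>
  obtain P0 where P0: "P0 \<ge> 1" "\<And>p. p \<ge> P0 \<Longrightarrow> M p > 1" "\<And>p. p \<ge> P0 \<Longrightarrow> W p \<noteq> {}"
  proof -
    obtain P1 where P1: "\<And>p. p \<ge> P1 \<Longrightarrow> M p > 1"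
      using M_top unfolding filterlim_at_top_dense eventually_sequentially by blast
    obtain P2 where P2: "P2 \<ge> 1" "\<And>p. p \<ge> P2 \<Longrightarrow> {undefined} \<subseteq> W p"
      using finite_subset_exhaustion[of W "{undefined}", OF W_mono W_exhausts] by auto
    show ?thesis
      by (rule that[of "max P1 P2"]) (use P1 P2 in auto)
  qed
  obtain z :: "nat \<Rightarrow> 'i c0" where z_finite: "\<And>k. finite {i. c0_nth (z k) i \<noteq> 0}"
    and z_dense: "\<And>u e. e > 0 \<Longrightarrow> \<exists>w. norm (w - u) < e \<and> (\<exists>\<^sub>\<infinity>k. z k = w)"
    using ex_dense_finitely_supported_c0 by blast
  \<comment> \<open>The default 0 is used as long as \<open>W p\<close> or \<open>M p\<close> is too
    small for \<open>z p\<close>.\<close>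
  define y where "y p = (if {i. c0_nth (z p) i \<noteq> 0} \<subseteq> W p \<and> norm (z p) \<le> M p then z p else 0)" for p
  have y_supp: "c0_nth (y p) i = 0" if "i \<notin> W p" for p i
    using that by (auto simp: y_def)
  have y_le: "\<bar>c0_nth (y p) i\<bar> \<le> M p" if "p \<ge> P0" for p i
    using abs_c0_nth_le_norm[of "y p" i] P0(2)[OF that] by (auto simp: y_def split: if_splits)
  \<comment> \<open>Discarding finitely many times makes all entries for \<open>p\<close> smaller than \<open>1 / p\<close>.\<close>
  define F where "F p = {n \<in> E p. \<forall>s\<in>W p. M p * real p < b n s}" for p
  have F_dens: "lower_density (F p) > 0" if "p \<ge> 1" for p
  proof (rule lower_density_pos_diff_finite[OF dens[OF that]])
    have "E p - F p \<subseteq> (\<Union>s\<in>W p. {n \<in> E p. b n s \<le> M p * real p})"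
      by (auto simp: F_def not_less)
    then show "finite (E p - F p)"
      by (rule finite_subset)
        (use that in \<open>auto intro!: W_finite finite_sublevel_if_filterlim_at_top weights\<close>)
  qed
  \<comment> \<open>A triple in \<open>Q\<close> prescribes the value \<open>val\<close> at the
    position \<open>h\<close>; injectivity of \<open>h\<close> makes the prescriptions
    consistent.\<close>
  define Q where "Q = {(p, n, s). P0 \<le> p \<and> n \<in> F p \<and> s \<in> W p}"
  define h where "h = (\<lambda>(p::nat, n, s). \<phi> n s)"
  define val where "val = (\<lambda>(p, n, s). c0_nth (y p) s / b n s)"
  have QD: "p \<ge> 1" "p \<ge> P0" "n \<in> E p" "n \<ge> 1" "s \<in> W p" "M p * real p < b n s" if "(p, n, s) \<in> Q" for p n s
    using that P0(1) E1[of p n] by (auto simp: Q_def F_def)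
  have h_inj: "inj_on h Q"
  proof (rule inj_onI)
    fix u v assume uv: "u \<in> Q" "v \<in> Q" "h u = h v"
    obtain p n s q m t where eq: "u = (p, n, s)" "v = (q, m, t)"
      by (metis prod_cases3)
    note u = QD[OF uv(1)[unfolded eq]] and v = QD[OF uv(2)[unfolded eq]]
    have phi: "\<phi> n s = \<phi> m t"
      using uv(3) by (simp add: eq h_def)
    have pq: "p = q"
      using sep[OF u(1) v(1) _ u(3) v(3)] phi u(5) v(5) by (metis disjoint_iff imageI)
    have nm: "n = m"
    proof (rule ccontr)
      assume nm: "n \<noteq> m"
      have M1: "1 / (M p * M p) < 1"
        using P0(2)[OF u(2)] by (simp add: less_1_mult)
      \<comment> \<open>Condition (d) applies in both directions, so a number and its inverse would
        both be below 1.\<close>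
      have "b n s / b m t < 1" "b m t / b n s < 1"
        using decay[OF u(1) v(1) u(3) v(3) nm v(5) phi]
          decay[OF v(1) u(1) v(3) u(3) nm[symmetric] u(5) phi[symmetric]] M1 pq by auto
      then show False
        using b_pos[OF u(4), of s] b_pos[OF v(4), of t] by simp
    qed
    then have "s = t"
      using phi inj[OF u(4)] by (auto dest: injD)
    then show "u = v"
      by (simp add: eq pq nm)
  qed
  define f where "f k = (if k \<in> h ` Q then val (inv_into Q h k) else 0)" for k
  have f_h: "f (\<phi> n s) = c0_nth (y p) s / b n s" if "(p, n, s) \<in> Q" for p n s
  proof -
    have h: "h (p, n, s) = \<phi> n s"
      by (simp add: h_def)
    show ?thesis
      using inv_into_f_f[OF h_inj that] imageI[OF that, of h] unfolding h by (simp add: f_def val_def)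
  qed
  have "\<exists>J. finite J \<and> (\<forall>i\<in>- J. \<bar>f i\<bar> < e)" if e: "e > 0" for e
  proof -
    \<comment> \<open>All triples that may carry an entry of size at least \<open>e\<close>.
      Membership in \<open>F p\<close> settles \<open>p > 1 / e\<close>; for the finitely many other
      \<open>p\<close>, condition (c) leaves finitely many times.\<close>
    define S where "S = (SIGMA p:{P0..nat \<lceil>1 / e\<rceil>}. \<Union>s\<in>W p. {n \<in> E p. b n s \<le> M p / e} \<times> {s})"
    have "finite S"
      unfolding S_def using P0(1)
      by (auto intro!: finite_SigmaI W_finite finite_sublevel_if_filterlim_at_top weights)
    moreover have "\<bar>f k\<bar> < e" if k: "k \<notin> h ` S" for k
    proof (cases "k \<in> h ` Q")
      case True
      then obtain p n s where Q: "(p, n, s) \<in> Q" and kh: "k = h (p, n, s)"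
        by auto
      note u = QD[OF Q]
      have b0: "b n s > 0"
        by (rule b_pos[OF u(4)])
      have "(p, n, s) \<notin> S"
        using k kh by blast
      then have "p > nat \<lceil>1 / e\<rceil> \<or> M p / e < b n s"
        using u by (auto simp: S_def)
      then have "M p < e * b n s"
      proof
        assume "p > nat \<lceil>1 / e\<rceil>"
        then have "1 / e \<le> real p"
          by linarith
        then have "M p * (1 / e) \<le> M p * real p"
          using P0(2)[OF u(2)] by (intro mult_left_mono) auto
        then have "M p * (1 / e) < b n s"
          using u(6) by linarith
        then show ?thesis
          using e by (simp add: field_simps)
      qed (use e in \<open>simp add: field_simps\<close>)
      then have "\<bar>c0_nth (y p) s\<bar> < e * b n s"
        using y_le[OF u(2), of s] by linarith
      moreover have "\<bar>f k\<bar> = \<bar>c0_nth (y p) s\<bar> / b n s"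
        using f_h[OF Q] b0 kh by (simp add: h_def abs_divide)
      ultimately show ?thesis
        using b0 by (simp add: pos_divide_less_eq)
    qed (use e in \<open>simp add: f_def\<close>)
    ultimately show ?thesis
      by (intro exI[of _ "h ` S"]) auto
  qed
  then have x: "c0_nth (Abs_c0 f) = f"
    by (intro Abs_c0_inverse) auto
  have close: "norm (T n (Abs_c0 f) - y p) \<le> 1 / M p" if p: "p \<ge> P0" and n: "n \<in> F p" for p n
  proof (rule c0_norm_le)
    fix i
    have p1: "p \<ge> 1" and nE: "n \<in> E p" and n1: "n \<ge> 1"
      using p P0(1) n E1[of p n] by (auto simp: F_def)
    have Mp: "M p > 1"
      by (rule P0(2)[OF p])
    have nth: "c0_nth (T n (Abs_c0 f)) i = b n i * f (\<phi> n i)"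
      by (simp add: weighted_pseudo_shift_nth[OF shifts[OF n1]] x)
    show "\<bar>c0_nth (T n (Abs_c0 f) - y p) i\<bar> \<le> 1 / M p"
    proof (cases "i \<in> W p")
      case True
      then have "(p, n, i) \<in> Q"
        using p n by (simp add: Q_def)
      then have "c0_nth (T n (Abs_c0 f) - y p) i = 0"
        using b_pos[OF n1, of i] by (simp add: nth f_h)
      then show ?thesis
        using Mp by simp
    next
      case False
      show ?thesis
      proof (cases "\<phi> n i \<in> h ` Q")
        case True
        then obtain q m t where Q: "(q, m, t) \<in> Q" and eq: "\<phi> n i = \<phi> m t"
          by (auto simp: h_def)
        note v = QD[OF Q]
        \<comment> \<open>Equal times force \<open>i = t\<close>, a point of \<open>W q\<close>
          outside \<open>W p\<close>, hence \<open>p < q\<close>. Then the nonempty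
          \<open>W p \<subseteq> W q\<close> violates (b) at the common time.\<close>
        have nm: "n \<noteq> m"
        proof
          assume nm: "n = m"
          then have it: "i = t"
            using eq inj[OF n1] by (auto dest: injD)
          have "\<not> q \<le> p"
            using False v(5) W_le[OF v(1), of p] it by auto
          then have pq: "p \<le> q" "p \<noteq> q"
            by auto
          obtain w where "w \<in> W p"
            using P0(3)[OF p] by auto
          then show False
            using sep[OF p1 v(1) pq(2) nE v(3)] W_le[OF p1 pq(1)] nm by auto
        qed
        have Mq: "M q > 1"
          by (rule P0(2)[OF v(2)])
        have "\<bar>c0_nth (T n (Abs_c0 f) - y p) i\<bar> = b n i / b m t * \<bar>c0_nth (y q) t\<bar>"
          using b_pos[OF n1, of i] b_pos[OF v(4), of t]
          by (simp add: nth y_supp[OF False] eq f_h[OF Q] abs_mult abs_divide)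
        \<comment> \<open>The factor \<open>1 / M q\<close> from (d) compensates the size of
          \<open>y q\<close>.\<close>
        also have "\<dots> \<le> 1 / (M p * M q) * M q"
          using decay[OF p1 v(1) nE v(3) nm v(5) eq] y_le[OF v(2), of t] Mp Mq
          by (intro mult_mono) auto
        also have "\<dots> = 1 / M p"
          using Mq by simp
        finally show ?thesis .
      next
        case outside: False
        then show ?thesis
          using Mp by (simp add: nth y_supp[OF False] f_def)
      qed
    qed
  qed
  show ?thesis
    unfolding frequently_universal_def
  proof (intro exI[of _ "Abs_c0 f"] allI impI, elim conjE)
    fix U :: "'i c0 set"
    assume U: "open U" "U \<noteq> {}"
    then obtain u e where u: "e > 0" "ball u e \<subseteq> U"
      by (meson equals0I open_contains_ball)
    obtain w where w: "norm (w - u) < e / 2" "\<exists>\<^sub>\<infinity>k. z k = w"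
      using z_dense[of "e / 2" u] u(1) by auto
    obtain k0 where "z k0 = w"
      using w(2) by (auto dest: INFM_EX)
    then have "finite {i. c0_nth w i \<noteq> 0}"
      using z_finite by auto
    then obtain P where P: "\<And>p. p \<ge> P \<Longrightarrow> {i. c0_nth w i \<noteq> 0} \<subseteq> W p"
      using finite_subset_exhaustion[of W, OF W_mono W_exhausts] by metis
    obtain P' where P': "\<And>p. p \<ge> P' \<Longrightarrow> max (norm w) (2 / e) < M p"
      using M_top unfolding filterlim_at_top_dense eventually_sequentially by blast
    \<comment> \<open>Infinite repetition of \<open>w\<close> allows an index beyond all three
      thresholds.\<close>
    obtain p where p: "p \<ge> max P0 (max P P')" "z p = w"
      using w(2) unfolding INFM_nat_le by blast
    have Mp: "norm w < M p" "2 / e < M p"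
      using P'[of p] p(1) by auto
    have yp: "y p = w"
      using P[of p] p Mp(1) by (auto simp: y_def)
    have "1 / M p < e / 2"
      using Mp(2) u(1) P0(2)[of p] p(1) by (simp add: field_simps)
    have "T n (Abs_c0 f) \<in> U" if "n \<in> F p" for n
    proof -
      have "norm (T n (Abs_c0 f) - w) < e / 2"
        using close[of p n] that p(1) yp \<open>1 / M p < e / 2\<close> by auto
      moreover have "norm (T n (Abs_c0 f) - u) \<le> norm (T n (Abs_c0 f) - w) + norm (w - u)"
        using norm_triangle_ineq[of "T n (Abs_c0 f) - w" "w - u"] by simp
      ultimately have "norm (T n (Abs_c0 f) - u) < e"
        using w(1) by linarith
      then show ?thesis
        using u(2) by (auto simp: dist_norm norm_minus_commute)
    qed
    moreover have "n \<ge> 1" if "n \<in> F p" for n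
      using that E1[of p n] P0(1) p(1) by (auto simp: F_def)
    ultimately have empty: "F p - {n. 1 \<le> n \<and> T n (Abs_c0 f) \<in> U} = {}"
      by auto
    have "p \<ge> 1"
      using P0(1) p(1) by simp
    then show "lower_density {n. 1 \<le> n \<and> T n (Abs_c0 f) \<in> U} > 0"
      by (rule lower_density_pos_diff_finite[OF F_dens]) (simp only: empty finite.emptyI)
  qed
qed

theorem theorem2p1:
  fixes T :: "nat \<Rightarrow> 'i::countable c0 \<Rightarrow> 'i c0"
    and b :: "nat \<Rightarrow> 'i \<Rightarrow> real"
    and \<phi> :: "nat \<Rightarrow> 'i \<Rightarrow> 'i"
    and W :: "nat \<Rightarrow> 'i set"
  assumes infinite_I: "infinite (UNIV :: 'i set)"
    and shifts: "\<And>n. n \<ge> 1 \<Longrightarrow> weighted_pseudo_shift (b n) (\<phi> n) (T n)"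
    and b_pos: "\<And>n i. n \<ge> 1 \<Longrightarrow> b n i > 0"
    and run_away: "run_away \<phi>"
    and ratio: "\<exists>\<rho>>1. \<forall>n\<ge>1. \<forall>m\<ge>1. \<forall>s t. \<phi> n s = \<phi> m t \<longrightarrow>
                  1 / \<rho> powr \<bar>real n - real m\<bar> \<le> b n s / b m t"
    and gap: "\<exists>g :: 'i \<Rightarrow> real. \<forall>n\<ge>1. \<forall>m\<ge>1. \<forall>s t. \<phi> n s = \<phi> m t \<longrightarrow>
                \<bar>real n - real m\<bar> \<le> \<bar>g s - g t\<bar>"
    and W_finite: "\<And>p. p \<ge> 1 \<Longrightarrow> finite (W p)"
    and W_mono: "\<And>p. p \<ge> 1 \<Longrightarrow> W p \<subseteq> W (Suc p)"
    and W_exhausts: "(\<Union>p\<in>{1..}. W p) = UNIV"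
  shows "(frequently_universal T \<longleftrightarrow>
            (\<exists>M. positive_divergent M \<and> (\<exists>E. separating_sets b \<phi> W M E))) \<and>
         (frequently_universal T \<longleftrightarrow>
            (\<forall>M. positive_divergent M \<longrightarrow> (\<exists>E. separating_sets b \<phi> W M E)))"
proof -
  obtain \<rho> where \<rho>: "\<rho> > 1" "\<And>n m s t. n \<ge> 1 \<Longrightarrow> m \<ge> 1 \<Longrightarrow> \<phi> n s = \<phi> m t \<Longrightarrow>
      1 / \<rho> powr \<bar>real n - real m\<bar> \<le> b n s / b m t"
    using ratio by blast
  obtain g :: "'i \<Rightarrow> real" where g: "\<And>n m s t. n \<ge> 1 \<Longrightarrow> m \<ge> 1 \<Longrightarrow> \<phi> n s = \<phi> m t \<Longrightarrow>
      \<bar>real n - real m\<bar> \<le> \<bar>g s - g t\<bar>"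
    using gap by blast
  have nec: "\<exists>E. separating_sets b \<phi> W M E" if "frequently_universal T" "positive_divergent M" for M
  proof -
    have "M p > 0" if "p \<ge> 1" for p
      using that \<open>positive_divergent M\<close> by (simp add: positive_divergent_def)
    from separating_sets_if_frequently_universal[where W = W and g = g and M = M,
        OF shifts b_pos run_away \<rho> g W_finite W_mono this that(1)]
    show ?thesis
      by blast
  qed
  have suf: "frequently_universal T" if "positive_divergent M" "separating_sets b \<phi> W M E" for M E
    using frequently_universal_if_separating_sets[where W = W,
        OF shifts b_pos W_finite W_mono W_exhausts that] .
  \<comment> \<open>An admissible \<open>M\<close> exists, so the condition for all \<open>M\<close>
    implies the condition for some \<open>M\<close>.\<close>
  have "positive_divergent real"
    by (simp add: positive_divergent_def filterlim_real_sequentially)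
  then show ?thesis
    using nec suf by blast
qed

end
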